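(* Suppose that the rank independence relation $\mathop{\perp\!\!\!\perp}^{\mathrm{rk}}$ (defined by $A \mathop{\perp\!\!\!\perp}^{\mathrm{rk}}_B C \Leftrightarrow \mathrm{rk}(A/BC)=\mathrm{rk}(A/B)$) is a stationary independence relation compatible with $\mathrm{acl}_M$. (1) For every $A, B \in \mathbf{A}(M)$, if $A \mathop{\perp\!\!\!\perp}^{\mathrm{rk}}_{A \cap B} B$, then $G_{(A\cap B)}=\langle G_{(A)} \cup G_{(B)} \rangle$. (2) Suppose in addition that $M$ has weak canonical bases. Then for every $A, B \in \mathbf{A}(M)$, $G_{(A\cap B)}=\langle G_{(A)} \cup G_{(B)} \rangle$.
   Context: $M$ is a countable structure in a countable language such that $\mathrm{acl}_M(A)=\mathrm{acl}^{\mathrm{g}}_M(A)$ for every finite $A\subseteq M$, where $\mathrm{acl}^{\mathrm{g}}_M(A)$ is the set of elements with finite orbit under the pointwise stabilizer $G_{(A)}$, and $G=\mathrm{Aut}(M)$. $\mathbf{A}(M)=\{\mathrm{acl}^{\mathrm{g}}_M(A): A\subseteq M \text{ finite}\}$; $G_{(A)}$ denotes the pointwise stabilizer; $AB$ denotes $A\cup B$. $\mathrm{rk}$ is an integer-valued dimension function on subsets of $M$: for $A,B\in\mathbf{A}(M)$ and $C\subseteq M$, (1) $\mathrm{rk}(g(C))=\mathrm{rk}(C)$ for $g\in G$; (2) $0\le \mathrm{rk}(A)\le \mathrm{rk}(AB)\le \mathrm{rk}(A)+\mathrm{rk}(B)-\mathrm{rk}(A\cap B)$; (3) if $A\subseteq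 B$ and $\mathrm{rk}(A)=\mathrm{rk}(B)$ then $A=B$; (4) $\mathrm{rk}(A)<\omega$; and $\mathrm{rk}(A/B)=\mathrm{rk}(AB)-\mathrm{rk}(B)$. A ternary relation $\mathop{\perp\!\!\!\perp}$ is a stationary independence relation compatible with $\mathrm{acl}_M$ if for all $A,B,C,D\in\mathbf{A}(M)$, $\mathrm{acl}_M$-closed $E$ and finite tuples $a,b$: (Compatibility) $a\mathop{\perp\!\!\!\perp}_b C\Leftrightarrow a\mathop{\perp\!\!\!\perp}_{\mathrm{acl}_M(b)}C$ and $a\mathop{\perp\!\!\!\perp}_B C\Leftrightarrow e\mathop{\perp\!\!\!\perp}_B C$ for all $e\in\mathrm{acl}_M(a,B)\Leftrightarrow \mathrm{acl}_M(a,B)\mathop{\perp\!\!\!\perp}_B C$; (Invariance) $A\mathop{\perp\!\!\!\perp}_B C$ implies $g(A)\mathop{\perp\!\!\!\perp}_{g(B)}g(C)$ for $g\in G$; (Monotonicity) $A\mathop{\perp\!\!\!\perp}_B CD$ implies $A\mathop{\perp\!\!\!\perp}_B C$ and $A\mathop{\perp\!\!\!\perp}_{BC}D$, and $A\mathop{\perp\!\!\!\perp}_B CE$ implies $A\mathop{\perp\!\!\!\perp}_B C$; (Transitivity) $A\mathop{\perp\!\!\!\perp}_B C$ and $A\mathop{\perp\!\!\!\perp}_{BC}D$ imply $A\mathop{\perp\!\!\!\perp}_B CD$; (Symmetry) $A\mathop{\perp\!\!\!\perp}_B C$ implies $C\mathop{\perp\!\!\!\perp}_B A$; (Existence) there is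 $g\in G_{(B)}$ with $g(A)\mathop{\perp\!\!\!\perp}_B C$; (Stationarity) if $B\subseteq A,D$, $A\mathop{\perp\!\!\!\perp}_B C$, $D\mathop{\perp\!\!\!\perp}_B C$ and $h:A\to D$ is the identity on $B$ and extends to an automorphism of $M$, then some $k\in\mathrm{Aut}(M)$ extends $h\cup\mathrm{id}_C$. $M$ has weak canonical bases (for $\mathop{\perp\!\!\!\perp}^{\mathrm{rk}}$) if for every $A\in\mathbf{A}(M)$ and $\mathrm{acl}_M$-closed $B$ there is a smallest $C\in\mathbf{A}(M)$ with $A\mathop{\perp\!\!\!\perp}^{\mathrm{rk}}_C B$. *)

theory Defs
  imports "HOL-Algebra.Generated_Groups" "HOL-Library.Extended_Real"
begin

text \<open>
  First-order structures. The universe is the whole type \<^typ>\<open>'a\<close>; the symbols of the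
  language are explicit sets, so that the language may have no function or no relation symbols.
\<close>

record ('f, 'r) language =
  funs :: "'f set"
  rels :: "'r set"
  farity :: "'f \<Rightarrow> nat"
  rarity :: "'r \<Rightarrow> nat"

record ('f, 'r, 'a) fo_structure = "('f, 'r) language" +
  fint :: "'f \<Rightarrow> 'a list \<Rightarrow> 'a"
  rint :: "'r \<Rightarrow> 'a list \<Rightarrow> bool"

datatype 'f trm = Var nat | Fn 'f "'f trm list"

datatype ('f, 'r) form =
    Eq "'f trm" "'f trm"
  | Rel 'r "'f trm list"
  | Neg "('f, 'r) form"
  | Conj "('f, 'r) form" "('f, 'r) form"
  | Ex nat "('f, 'r) form"

primrec wf_trm :: "('f, 'r, 'z) language_scheme \<Rightarrow> 'f trm \<Rightarrow> bool" where
  "wf_trm L (Var n) \<longleftrightarrow> True"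
| "wf_trm L (Fn f ts) \<longleftrightarrow>
     f \<in> funs L \<and> length ts = farity L f \<and> list_all (\<lambda>b. b) (map (wf_trm L) ts)"

primrec wf_form :: "('f, 'r, 'z) language_scheme \<Rightarrow> ('f, 'r) form \<Rightarrow> bool" where
  "wf_form L (Eq s t) \<longleftrightarrow> wf_trm L s \<and> wf_trm L t"
| "wf_form L (Rel r ts) \<longleftrightarrow> r \<in> rels L \<and> length ts = rarity L r \<and> list_all (wf_trm L) ts"
| "wf_form L (Neg p) \<longleftrightarrow> wf_form L p"
| "wf_form L (Conj p q) \<longleftrightarrow> wf_form L p \<and> wf_form L q"
| "wf_form L (Ex n p) \<longleftrightarrow> wf_form L p"

primrec fv_trm :: "'f trm \<Rightarrow> nat set" where
  "fv_trm (Var n) = {n}"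
| "fv_trm (Fn f ts) = \<Union> (set (map fv_trm ts))"

primrec fv_form :: "('f, 'r) form \<Rightarrow> nat set" where
  "fv_form (Eq s t) = fv_trm s \<union> fv_trm t"
| "fv_form (Rel r ts) = \<Union> (set (map fv_trm ts))"
| "fv_form (Neg p) = fv_form p"
| "fv_form (Conj p q) = fv_form p \<union> fv_form q"
| "fv_form (Ex n p) = fv_form p - {n}"

primrec eval_trm :: "('f, 'r, 'a) fo_structure \<Rightarrow> (nat \<Rightarrow> 'a) \<Rightarrow> 'f trm \<Rightarrow> 'a" where
  "eval_trm M v (Var n) = v n"
| "eval_trm M v (Fn f ts) = fint M f (map (eval_trm M v) ts)"

primrec sat :: "('f, 'r, 'a) fo_structure \<Rightarrow> (nat \<Rightarrow> 'a) \<Rightarrow> ('f, 'r) form \<Rightarrow> bool" where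
  "sat M v (Eq s t) \<longleftrightarrow> eval_trm M v s = eval_trm M v t"
| "sat M v (Rel r ts) \<longleftrightarrow> rint M r (map (eval_trm M v) ts)"
| "sat M v (Neg p) \<longleftrightarrow> \<not> sat M v p"
| "sat M v (Conj p q) \<longleftrightarrow> sat M v p \<and> sat M v q"
| "sat M v (Ex n p) \<longleftrightarrow> (\<exists>y. sat M (v(n := y)) p)"

definition countable_language :: "('f, 'r, 'z) language_scheme \<Rightarrow> bool" where
  "countable_language L \<longleftrightarrow> countable (funs L) \<and> countable (rels L)"

text \<open>
  Model-theoretic algebraic closure: variable 0 is the object variable, the valuation assigns
  parameters from \<^term>\<open>A\<close> to all other free variables.
\<close>

definition acl :: "('f, 'r, 'a) fo_structure \<Rightarrow> 'a set \<Rightarrow> 'a set" where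
  "acl M A = {x. \<exists>p v. wf_form M p \<and> (\<forall>n \<in> fv_form p - {0}. v n \<in> A) \<and>
                 finite {y. sat M (v(0 := y)) p} \<and> sat M (v(0 := x)) p}"

definition Aut :: "('f, 'r, 'a) fo_structure \<Rightarrow> ('a \<Rightarrow> 'a) set" where
  "Aut M = {g. bij g \<and>
     (\<forall>f \<in> funs M. \<forall>xs. length xs = farity M f \<longrightarrow> g (fint M f xs) = fint M f (map g xs)) \<and>
     (\<forall>r \<in> rels M. \<forall>xs. length xs = rarity M r \<longrightarrow> (rint M r (map g xs) \<longleftrightarrow> rint M r xs))}"

definition Aut_group :: "('f, 'r, 'a) fo_structure \<Rightarrow> ('a \<Rightarrow> 'a) monoid" where
  "Aut_group M = \<lparr>carrier = Aut M, mult = (\<circ>), one = id\<rparr>"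

definition pstab :: "('f, 'r, 'a) fo_structure \<Rightarrow> 'a set \<Rightarrow> ('a \<Rightarrow> 'a) set" where
  "pstab M A = {g \<in> Aut M. \<forall>x \<in> A. g x = x}"

definition acl_g :: "('f, 'r, 'a) fo_structure \<Rightarrow> 'a set \<Rightarrow> 'a set" where
  "acl_g M A = {x. finite {g x |g. g \<in> pstab M A}}"

definition fg_closed :: "('f, 'r, 'a) fo_structure \<Rightarrow> 'a set set" where
  "fg_closed M = {acl_g M A |A. finite A}"

text \<open>
  Ranks are integers or \<^term>\<open>\<infinity> :: ereal\<close>; the value \<^term>\<open>\<infinity> :: ereal\<close> is needed for sets
  that are not algebraic closures of finite sets.
\<close>

definition dimension_function ::
    "('f, 'r, 'a) fo_structure \<Rightarrow> ('a set \<Rightarrow> ereal) \<Rightarrow> bool" where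
  "dimension_function M rk \<longleftrightarrow>
     (\<forall>C. rk C = \<infinity> \<or> (\<exists>n :: int. rk C = ereal (of_int n))) \<and>
     (\<forall>C. \<forall>g \<in> Aut M. rk (g ` C) = rk C) \<and>
     (\<forall>A \<in> fg_closed M. \<forall>B \<in> fg_closed M.
        0 \<le> rk A \<and> rk A \<le> rk (A \<union> B) \<and> rk (A \<union> B) \<le> rk A + rk B - rk (A \<inter> B)) \<and>
     (\<forall>A \<in> fg_closed M. \<forall>B \<in> fg_closed M. A \<subseteq> B \<longrightarrow> rk A = rk B \<longrightarrow> A = B) \<and>
     (\<forall>A \<in> fg_closed M. rk A < \<infinity>)"

text \<open>
  The relative rank of \<^term>\<open>A\<close> over \<^term>\<open>B\<close>. If \<^term>\<open>B\<close> has infinite rank, the difference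
  is meaningless and the rank over \<^term>\<open>B\<close> is, as usual, the least rank over the closure of a
  finite subset of \<^term>\<open>B\<close>.
\<close>

definition rel_rk ::
    "('f, 'r, 'a) fo_structure \<Rightarrow> ('a set \<Rightarrow> ereal) \<Rightarrow> 'a set \<Rightarrow> 'a set \<Rightarrow> ereal" where
  "rel_rk M rk A B =
     (if rk B < \<infinity> then rk (A \<union> B) - rk B
      else (INF F \<in> {F. finite F \<and> F \<subseteq> B}. rk (A \<union> acl M F) - rk (acl M F)))"

text \<open>In ternary relations the base is the second argument.\<close>

definition rk_indep ::
    "('f, 'r, 'a) fo_structure \<Rightarrow> ('a set \<Rightarrow> ereal) \<Rightarrow> 'a set \<Rightarrow> 'a set \<Rightarrow> 'a set \<Rightarrow> bool" where
  "rk_indep M rk A B C \<longleftrightarrow> rel_rk M rk A (B \<union> C) = rel_rk M rk A B"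

text \<open>Finite tuples are lists; as arguments of the relation they stand for their sets of entries.\<close>

definition indep_compatible ::
    "('f, 'r, 'a) fo_structure \<Rightarrow> ('a set \<Rightarrow> 'a set \<Rightarrow> 'a set \<Rightarrow> bool) \<Rightarrow> bool" where
  "indep_compatible M ind \<longleftrightarrow>
     (\<forall>a b. \<forall>C \<in> fg_closed M. ind (set a) (set b) C \<longleftrightarrow> ind (set a) (acl M (set b)) C) \<and>
     (\<forall>a. \<forall>B \<in> fg_closed M. \<forall>C \<in> fg_closed M.
        (ind (set a) B C \<longleftrightarrow> (\<forall>e. set e \<subseteq> acl M (set a \<union> B) \<longrightarrow> ind (set e) B C)) \<and>
        ((\<forall>e. set e \<subseteq> acl M (set a \<union> B) \<longrightarrow> ind (set e) B C) \<longleftrightarrow>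
           ind (acl M (set a \<union> B)) B C))"

definition indep_invariant ::
    "('f, 'r, 'a) fo_structure \<Rightarrow> ('a set \<Rightarrow> 'a set \<Rightarrow> 'a set \<Rightarrow> bool) \<Rightarrow> bool" where
  "indep_invariant M ind \<longleftrightarrow>
     (\<forall>A \<in> fg_closed M. \<forall>B \<in> fg_closed M. \<forall>C \<in> fg_closed M. \<forall>g \<in> Aut M.
        ind A B C \<longrightarrow> ind (g ` A) (g ` B) (g ` C))"

definition indep_monotone ::
    "('f, 'r, 'a) fo_structure \<Rightarrow> ('a set \<Rightarrow> 'a set \<Rightarrow> 'a set \<Rightarrow> bool) \<Rightarrow> bool" where
  "indep_monotone M ind \<longleftrightarrow>
     (\<forall>A \<in> fg_closed M. \<forall>B \<in> fg_closed M. \<forall>C \<in> fg_closed M. \<forall>D \<in> fg_closed M.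
        ind A B (C \<union> D) \<longrightarrow> ind A B C \<and> ind A (B \<union> C) D) \<and>
     (\<forall>A \<in> fg_closed M. \<forall>B \<in> fg_closed M. \<forall>C \<in> fg_closed M. \<forall>E. acl M E = E \<longrightarrow>
        ind A B (C \<union> E) \<longrightarrow> ind A B C)"

definition indep_transitive ::
    "('f, 'r, 'a) fo_structure \<Rightarrow> ('a set \<Rightarrow> 'a set \<Rightarrow> 'a set \<Rightarrow> bool) \<Rightarrow> bool" where
  "indep_transitive M ind \<longleftrightarrow>
     (\<forall>A \<in> fg_closed M. \<forall>B \<in> fg_closed M. \<forall>C \<in> fg_closed M. \<forall>D \<in> fg_closed M.
        ind A B C \<longrightarrow> ind A (B \<union> C) D \<longrightarrow> ind A B (C \<union> D))"

definition indep_symmetric ::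
    "('f, 'r, 'a) fo_structure \<Rightarrow> ('a set \<Rightarrow> 'a set \<Rightarrow> 'a set \<Rightarrow> bool) \<Rightarrow> bool" where
  "indep_symmetric M ind \<longleftrightarrow>
     (\<forall>A \<in> fg_closed M. \<forall>B \<in> fg_closed M. \<forall>C \<in> fg_closed M. ind A B C \<longrightarrow> ind C B A)"

definition indep_existence ::
    "('f, 'r, 'a) fo_structure \<Rightarrow> ('a set \<Rightarrow> 'a set \<Rightarrow> 'a set \<Rightarrow> bool) \<Rightarrow> bool" where
  "indep_existence M ind \<longleftrightarrow>
     (\<forall>A \<in> fg_closed M. \<forall>B \<in> fg_closed M. \<forall>C \<in> fg_closed M. \<exists>g \<in> pstab M B. ind (g ` A) B C)"

definition indep_stationary ::
    "('f, 'r, 'a) fo_structure \<Rightarrow> ('a set \<Rightarrow> 'a set \<Rightarrow> 'a set \<Rightarrow> bool) \<Rightarrow> bool" where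
  "indep_stationary M ind \<longleftrightarrow>
     (\<forall>A \<in> fg_closed M. \<forall>B \<in> fg_closed M. \<forall>C \<in> fg_closed M. \<forall>D \<in> fg_closed M. \<forall>h.
        B \<subseteq> A \<longrightarrow> B \<subseteq> D \<longrightarrow> ind A B C \<longrightarrow> ind D B C \<longrightarrow>
        h \<in> A \<rightarrow> D \<longrightarrow> (\<forall>x \<in> B. h x = x) \<longrightarrow> (\<exists>g \<in> Aut M. \<forall>x \<in> A. g x = h x) \<longrightarrow>
        (\<exists>k \<in> Aut M. (\<forall>x \<in> A. k x = h x) \<and> (\<forall>x \<in> C. k x = x)))"

definition stationary_independence ::
    "('f, 'r, 'a) fo_structure \<Rightarrow> ('a set \<Rightarrow> 'a set \<Rightarrow> 'a set \<Rightarrow> bool) \<Rightarrow> bool" where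
  "stationary_independence M ind \<longleftrightarrow>
     indep_compatible M ind \<and> indep_invariant M ind \<and> indep_monotone M ind \<and>
     indep_transitive M ind \<and> indep_symmetric M ind \<and> indep_existence M ind \<and>
     indep_stationary M ind"

definition weak_canonical_bases ::
    "('f, 'r, 'a) fo_structure \<Rightarrow> ('a set \<Rightarrow> 'a set \<Rightarrow> 'a set \<Rightarrow> bool) \<Rightarrow> bool" where
  "weak_canonical_bases M ind \<longleftrightarrow>
     (\<forall>A \<in> fg_closed M. \<forall>B. acl M B = B \<longrightarrow>
        (\<exists>C \<in> fg_closed M. ind A C B \<and> (\<forall>C' \<in> fg_closed M. ind A C' B \<longrightarrow> C \<subseteq> C')))"

lemma Aut_id: "id \<in> Aut M"
  by (simp add: Aut_def)

lemma Aut_comp: "g \<in> Aut M \<Longrightarrow> h \<in> Aut M \<Longrightarrow> g \<circ> h \<in> Aut M"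
  by (auto simp: Aut_def bij_comp simp flip: map_map)

lemma Aut_inv: assumes g: "g \<in> Aut M" shows "inv_into UNIV g \<in> Aut M"
proof -
  let ?i = "inv_into UNIV g"
  have b: "bij g" using g by (simp add: Aut_def)
  then have gi: "g (?i x) = x" and ig: "?i (g x) = x" for x
    by (simp_all add: bij_is_surj surj_f_inv_f bij_is_inj)
  have m: "map g (map ?i xs) = xs" for xs by (induction xs) (simp_all add: gi)
  have "?i (fint M f xs) = fint M f (map ?i xs)" if "f \<in> funs M" "length xs = farity M f" for f xs
  proof -
    have "g (fint M f (map ?i xs)) = fint M f (map g (map ?i xs))"
      using g that unfolding Aut_def by (metis (mono_tags, lifting) length_map mem_Collect_eq)
    then show ?thesis using m ig by metis
  qed
  moreover have "rint M r (map ?i xs) \<longleftrightarrow> rint M r xs"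
    if "r \<in> rels M" "length xs = rarity M r" for r xs
  proof -
    have "rint M r (map g (map ?i xs)) \<longleftrightarrow> rint M r (map ?i xs)"
      using g that unfolding Aut_def by (metis (mono_tags, lifting) length_map mem_Collect_eq)
    then show ?thesis using m by metis
  qed
  ultimately show ?thesis using b by (simp add: Aut_def bij_imp_bij_inv)
qed

lemma group_Aut_group: "group (Aut_group M)"
proof (rule groupI)
  fix g assume "g \<in> carrier (Aut_group M)"
  then have g: "g \<in> Aut M" by (simp add: Aut_group_def)
  then have "inv_into UNIV g \<circ> g = id" by (simp add: Aut_def bij_is_inj)
  then show "\<exists>h \<in> carrier (Aut_group M). h \<otimes>\<^bsub>Aut_group M\<^esub> g = \<one>\<^bsub>Aut_group M\<^esub>"
    using Aut_inv[OF g] by (auto simp: Aut_group_def)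
qed (auto simp: Aut_group_def Aut_id Aut_comp)

end

theory Submission imports Defs begin

text \<open>
  Suppose \<open>A\<close> and \<open>B\<close> are independent over \<open>C \<subseteq> A \<inter> B\<close>, and let \<open>g\<close> fix \<open>C\<close> pointwise. Existence
  gives \<open>k \<in> G\<^bsub>(B)\<^esub>\<close> such that \<open>k(A)\<close> is independent from \<open>acl(A, g(A))\<close> over \<open>B\<close>, hence over \<open>C\<close>.
  Stationarity yields \<open>m \<in> G\<^bsub>(k(A))\<^esub> = k G\<^bsub>(A)\<^esub> k\<^sup>-\<^sup>1\<close> that agrees with \<open>g\<close> on \<open>A\<close>, so \<open>g\<close> is a product
  of \<open>m\<close> and an element of \<open>G\<^bsub>(A)\<^esub>\<close>.

  For arbitrary \<open>A\<close> and \<open>B\<close>, choose \<open>k \<in> G\<^bsub>(B)\<^esub>\<close> with \<open>k(A)\<close> independent from \<open>A\<close> over \<open>B\<close>. The weak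
  canonical base of \<open>k(A)\<close> over \<open>A\<close> lies both in \<open>A\<close> and in \<open>B\<close>, so \<open>k(A)\<close> and \<open>A\<close> are independent
  over \<open>A \<inter> B\<close>. By the first part, \<open>G\<^bsub>(A \<inter> B)\<^esub>\<close> is generated by \<open>G\<^bsub>(A)\<^esub>\<close> and its conjugate by \<open>k\<close>.
\<close>

section \<open>Automorphisms, pointwise stabilizers and the groups they generate\<close>

lemma Aut_bij: "g \<in> Aut M \<Longrightarrow> bij g"
  by (simp add: Aut_def)

lemma Aut_inv_left: "g \<in> Aut M \<Longrightarrow> inv_into UNIV g (g x) = x"
  by (simp add: Aut_bij bij_is_inj)

lemma Aut_inv_right: "g \<in> Aut M \<Longrightarrow> g (inv_into UNIV g x) = x"
  by (simp add: Aut_bij bij_is_surj surj_f_inv_f)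

lemma pstab_Aut: "g \<in> pstab M A \<Longrightarrow> g \<in> Aut M"
  by (simp add: pstab_def)

lemma pstab_fix: "g \<in> pstab M A \<Longrightarrow> x \<in> A \<Longrightarrow> g x = x"
  by (simp add: pstab_def)

lemma pstab_antimono: "A \<subseteq> B \<Longrightarrow> pstab M B \<subseteq> pstab M A"
  by (auto simp: pstab_def)

lemma pstab_image_fix: "g \<in> pstab M A \<Longrightarrow> C \<subseteq> A \<Longrightarrow> g ` C = C"
  by (force simp: pstab_def)

lemma pstab_inv: "g \<in> pstab M A \<Longrightarrow> inv_into UNIV g \<in> pstab M A"
  unfolding pstab_def by (auto simp: Aut_inv) (metis Aut_inv_left)

lemma pstab_comp: "g \<in> pstab M A \<Longrightarrow> h \<in> pstab M A \<Longrightarrow> g \<circ> h \<in> pstab M A"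
  by (simp add: pstab_def Aut_comp)

lemma inv_comp_in_pstab:
  assumes "g \<in> Aut M" "h \<in> Aut M" "\<And>x. x \<in> A \<Longrightarrow> g x = h x"
  shows "inv_into UNIV h \<circ> g \<in> pstab M A"
  using assms by (simp add: pstab_def Aut_comp Aut_inv Aut_inv_left)

lemma conj_in_pstab:
  assumes "k \<in> Aut M" "m \<in> pstab M (k ` A)"
  shows "inv_into UNIV k \<circ> m \<circ> k \<in> pstab M A"
  using assms by (simp add: pstab_def Aut_comp Aut_inv Aut_inv_left)

lemma Aut_group_inv: "g \<in> Aut M \<Longrightarrow> inv\<^bsub>Aut_group M\<^esub> g = inv_into UNIV g"
  by (rule group.inv_equality[OF group_Aut_group])
    (auto simp: Aut_group_def Aut_inv Aut_inv_left)

lemma subgroup_pstab: "subgroup (pstab M A) (Aut_group M)"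
proof (rule group.subgroupI[OF group_Aut_group])
  show "pstab M A \<subseteq> carrier (Aut_group M)"
    by (auto simp: Aut_group_def pstab_def)
  show "pstab M A \<noteq> {}"
    using Aut_id by (fastforce simp: pstab_def)
  show "inv\<^bsub>Aut_group M\<^esub> g \<in> pstab M A" if "g \<in> pstab M A" for g
    using that by (simp add: Aut_group_inv pstab_Aut pstab_inv)
  show "g \<otimes>\<^bsub>Aut_group M\<^esub> h \<in> pstab M A" if "g \<in> pstab M A" "h \<in> pstab M A" for g h
    using that by (simp add: Aut_group_def pstab_comp)
qed

lemma generate_Aut_comp:
  "g \<in> generate (Aut_group M) S \<Longrightarrow> h \<in> generate (Aut_group M) S \<Longrightarrow>
     g \<circ> h \<in> generate (Aut_group M) S"
  using generate.eng[of g "Aut_group M" S h] by (simp add: Aut_group_def)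

lemma generate_pstab_subset:
  "C \<subseteq> A \<Longrightarrow> C \<subseteq> B \<Longrightarrow> generate (Aut_group M) (pstab M A \<union> pstab M B) \<subseteq> pstab M C"
  by (rule group.generate_subgroup_incl[OF group_Aut_group _ subgroup_pstab])
    (use pstab_antimono in blast)

text \<open>The stabilizer of the image of \<open>A\<close> is the conjugate of
  \<open>pstab M A\<close> by \<open>k\<close>, and \<open>k\<close> itself is among the
  generators.\<close>

lemma pstab_conj_subset_generate:
  assumes "k \<in> pstab M B"
  shows "pstab M (k ` A) \<subseteq> generate (Aut_group M) (pstab M A \<union> pstab M B)"
proof
  let ?H = "generate (Aut_group M) (pstab M A \<union> pstab M B)"
  fix m assume m: "m \<in> pstab M (k ` A)"
  have k: "k \<in> Aut M"
    using assms by (rule pstab_Aut)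
  have "inv_into UNIV k \<circ> m \<circ> k \<in> ?H"
    using conj_in_pstab[OF k m] by (blast intro: generate.incl)
  moreover have "k \<in> ?H" "inv_into UNIV k \<in> ?H"
    using assms pstab_inv[OF assms] by (blast intro: generate.incl)+
  ultimately have "k \<circ> (inv_into UNIV k \<circ> m \<circ> k) \<circ> inv_into UNIV k \<in> ?H"
    by (blast intro: generate_Aut_comp)
  moreover have "k \<circ> (inv_into UNIV k \<circ> m \<circ> k) \<circ> inv_into UNIV k = m"
    by (simp add: fun_eq_iff Aut_inv_right[OF k])
  ultimately show "m \<in> ?H"
    by simp
qed

section \<open>Group-theoretic closure and finitely generated closed sets\<close>

lemma acl_g_mono: "A \<subseteq> B \<Longrightarrow> acl_g M A \<subseteq> acl_g M B"
  unfolding acl_g_def using pstab_antimono[of A B M]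
  by (auto elim!: rev_finite_subset)

lemma acl_g_extensive: "A \<subseteq> acl_g M A"
proof
  fix x assume "x \<in> A"
  then have "{g x |g. g \<in> pstab M A} \<subseteq> {x}"
    by (auto simp: pstab_fix)
  then show "x \<in> acl_g M A"
    unfolding acl_g_def by (simp add: finite_subset)
qed

text \<open>
  Since \<open>F\<close> is finite and its points have finite orbits under \<open>G\<^bsub>(A)\<^esub>\<close>, the elements of \<open>G\<^bsub>(A)\<^esub>\<close> have
  only finitely many restrictions to \<open>F\<close>, so \<open>G\<^bsub>(A \<union> F)\<^esub>\<close> has finite index in \<open>G\<^bsub>(A)\<^esub>\<close>.
\<close>

lemma acl_g_subset_acl_g:
  assumes F: "finite F" "F \<subseteq> acl_g M A"
  shows "acl_g M F \<subseteq> acl_g M A"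
proof
  fix x assume "x \<in> acl_g M F"
  then have fin: "finite {g x |g. g \<in> pstab M F}" (is "finite ?O")
    by (simp add: acl_g_def)
  let ?K = "pstab M A"
  let ?r = "\<lambda>g. restrict g F"
  let ?s = "inv_into ?K ?r"
  have "?r ` ?K \<subseteq> (\<Pi>\<^sub>E y\<in>F. {g y |g. g \<in> ?K})"
    by auto
  moreover have "finite (\<Pi>\<^sub>E y\<in>F. {g y |g. g \<in> ?K})"
    using F by (intro finite_PiE) (auto simp: acl_g_def)
  ultimately have "finite (?r ` ?K)"
    by (rule finite_subset)
  then have "finite (\<Union>r \<in> ?r ` ?K. ?s r ` ?O)"
    using fin by blast
  moreover have "{g x |g. g \<in> ?K} \<subseteq> (\<Union>r \<in> ?r ` ?K. ?s r ` ?O)"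
  proof clarify
    fix g assume g: "g \<in> ?K"
    \<comment> \<open>\<open>h\<close> is the chosen representative with the same restriction to
      \<open>F\<close> as \<open>g\<close>. The two differ by an element fixing \<open>F\<close>, so
      \<open>g x\<close> lies in the translate of \<open>?O\<close> by \<open>h\<close>.\<close>
    define h where "h = ?s (?r g)"
    have h: "h \<in> ?K" and "?r h = ?r g"
      unfolding h_def using g
      by (simp_all add: inv_into_into f_inv_into_f[of _ ?r] del: restrict_apply)
    then have "g y = h y" if "y \<in> F" for y
      using that by (metis restrict_apply')
    then have "inv_into UNIV h \<circ> g \<in> pstab M F"
      using g h by (intro inv_comp_in_pstab) (auto dest: pstab_Aut)
    then have "(inv_into UNIV h \<circ> g) x \<in> ?O"
      by blast
    moreover have "g x = h ((inv_into UNIV h \<circ> g) x)"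
      by (simp add: Aut_inv_right[OF pstab_Aut[OF h]])
    ultimately have "g x \<in> h ` ?O"
      by (rule rev_image_eqI)
    then show "g x \<in> (\<Union>r \<in> ?r ` ?K. ?s r ` ?O)"
      unfolding h_def using g by blast
  qed
  ultimately show "x \<in> acl_g M A"
    unfolding acl_g_def by (simp add: finite_subset)
qed

text \<open>Conjugation by \<open>g\<close> relates the two stabilizers, so the orbit of
  \<open>g x\<close> lies in the image of the finite orbit of \<open>x\<close>.\<close>

lemma image_acl_g_subset:
  assumes g: "g \<in> Aut M"
  shows "g ` acl_g M A \<subseteq> acl_g M (g ` A)"
proof clarify
  fix x assume "x \<in> acl_g M A"
  then have "finite (g ` {h x |h. h \<in> pstab M A})"
    by (simp add: acl_g_def)
  moreover have "{h (g x) |h. h \<in> pstab M (g ` A)} \<subseteq> g ` {h x |h. h \<in> pstab M A}"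
  proof clarify
    fix h assume "h \<in> pstab M (g ` A)"
    then have "inv_into UNIV g \<circ> h \<circ> g \<in> pstab M A"
      using g by (simp add: conj_in_pstab)
    moreover have "h (g x) = g ((inv_into UNIV g \<circ> h \<circ> g) x)"
      using g by (simp add: Aut_inv_right)
    ultimately show "h (g x) \<in> g ` {h x |h. h \<in> pstab M A}"
      by blast
  qed
  ultimately show "g x \<in> acl_g M (g ` A)"
    unfolding acl_g_def by (simp add: finite_subset)
qed

lemma acl_g_image:
  assumes g: "g \<in> Aut M"
  shows "acl_g M (g ` A) = g ` acl_g M A"
proof
  have "inv_into UNIV g ` acl_g M (g ` A) \<subseteq> acl_g M A"
    using image_acl_g_subset[OF Aut_inv[OF g], of "g ` A"] g
    by (simp add: image_image Aut_inv_left)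
  then show "acl_g M (g ` A) \<subseteq> g ` acl_g M A"
    using Aut_inv_right[OF g] by (metis image_eqI image_subset_iff subsetI)
qed (rule image_acl_g_subset[OF g])

lemma fg_closed_acl_g: "finite F \<Longrightarrow> acl_g M F \<in> fg_closed M"
  by (auto simp: fg_closed_def)

lemma fg_closed_image:
  assumes "g \<in> Aut M" "A \<in> fg_closed M"
  shows "g ` A \<in> fg_closed M"
proof -
  obtain F where "finite F" "A = acl_g M F"
    using assms(2) by (auto simp: fg_closed_def)
  then show ?thesis
    using fg_closed_acl_g[of "g ` F" M] by (simp add: acl_g_image[OF assms(1)])
qed

lemma acl_g_subset_fg_closed:
  assumes "A \<in> fg_closed M" "finite F" "F \<subseteq> A"
  shows "acl_g M F \<subseteq> A"
proof -
  obtain E where "A = acl_g M E"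
    using assms(1) by (auto simp: fg_closed_def)
  then show ?thesis
    using acl_g_subset_acl_g assms by blast
qed

lemma fg_closed_upper_bound:
  assumes "A \<in> fg_closed M" "B \<in> fg_closed M"
  obtains D where "D \<in> fg_closed M" "A \<subseteq> D" "B \<subseteq> D"
proof -
  obtain E F where "finite E" "A = acl_g M E" "finite F" "B = acl_g M F"
    using assms by (auto simp: fg_closed_def)
  then show ?thesis
    using that[of "acl_g M (E \<union> F)"] by (simp add: fg_closed_acl_g acl_g_mono)
qed

section \<open>Model-theoretic algebraic closure\<close>

lemma finite_fv_trm: "finite (fv_trm t)"
  by (induction t) auto

lemma finite_fv_form: "finite (fv_form p)"
  by (induction p) (auto simp: finite_fv_trm)

text \<open>A formula has only finitely many free variables, hence uses only finitely many
  parameters.\<close>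

lemma acl_finite_character:
  assumes "x \<in> acl M A"
  obtains F where "finite F" "F \<subseteq> A" "x \<in> acl M F"
proof -
  obtain p v where p: "wf_form M p" "\<forall>n \<in> fv_form p - {0}. v n \<in> A"
      "finite {y. sat M (v(0 := y)) p}" "sat M (v(0 := x)) p"
    using assms by (auto simp: acl_def)
  show ?thesis
  proof (rule that)
    show "finite (v ` (fv_form p - {0}))"
      by (simp add: finite_fv_form)
    show "v ` (fv_form p - {0}) \<subseteq> A"
      using p by blast
    show "x \<in> acl M (v ` (fv_form p - {0}))"
      unfolding acl_def using p by blast
  qed
qed

lemma acl_extensive: "A \<subseteq> acl M A"
proof
  fix x assume "x \<in> A"
  then show "x \<in> acl M A"
    unfolding acl_def
    \<comment> \<open>The formula "variable 0 equals variable 1", with variable 1 set to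
      \<open>x\<close>, has \<open>x\<close> as its only solution.\<close>
    by (intro CollectI exI[of _ "Eq (Var 0) (Var 1)"] exI[of _ "\<lambda>_. x"]) auto
qed

text \<open>The two closures are assumed equal on finite sets only, while \<open>A\<close> may be
  infinite; finite character bridges the gap. Weak canonical bases need \<open>A\<close> to be
  closed under \<open>acl\<close>.\<close>

lemma acl_fg_closed:
  assumes acl: "\<And>F. finite F \<Longrightarrow> acl M F = acl_g M F" and A: "A \<in> fg_closed M"
  shows "acl M A = A"
proof
  show "acl M A \<subseteq> A"
  proof
    fix x assume "x \<in> acl M A"
    then obtain F where "finite F" "F \<subseteq> A" "x \<in> acl M F"
      by (rule acl_finite_character)
    then show "x \<in> A"
      using acl acl_g_subset_fg_closed[OF A] by blast
  qed
qed (rule acl_extensive)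

section \<open>Rank and intersections of closed sets\<close>

lemma dimension_function_mono:
  assumes "dimension_function M rk" "A \<in> fg_closed M" "B \<in> fg_closed M" "A \<subseteq> B"
  shows "rk A \<le> rk B"
  using assms unfolding dimension_function_def by (metis Un_absorb1)

lemma dimension_function_nat:
  assumes "dimension_function M rk" "A \<in> fg_closed M"
  obtains n :: nat where "rk A = ereal (real n)"
proof -
  obtain i :: int where "rk A = ereal (of_int i)" "0 \<le> rk A"
    using assms unfolding dimension_function_def by (metis less_irrefl)
  then show ?thesis
    using that[of "nat i"] by simp
qed

text \<open>
  A finite subset of \<open>A \<inter> B\<close> whose closure has maximal rank generates \<open>A \<inter> B\<close>.
\<close>

lemma fg_closed_Int:
  assumes rk: "dimension_function M rk" and A: "A \<in> fg_closed M" and B: "B \<in> fg_closed M"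
  shows "A \<inter> B \<in> fg_closed M"
proof -
  \<comment> \<open>Ranks are read as natural numbers, so that a bounded family of them attains a
    maximum.\<close>
  define r where "r F = (SOME n::nat. rk (acl_g M F) = ereal (real n))" for F
  have r: "rk (acl_g M F) = ereal (real (r F))" if "finite F" for F
    unfolding r_def using dimension_function_nat[OF rk fg_closed_acl_g[OF that]]
    by (metis (mono_tags, lifting) someI)
  obtain N :: nat where N: "rk A = ereal (real N)"
    using dimension_function_nat[OF rk A] .
  let ?P = "\<lambda>F. finite F \<and> F \<subseteq> A \<inter> B"
  have closed: "acl_g M F \<subseteq> A \<inter> B" if "?P F" for F
    using that acl_g_subset_fg_closed[OF A] acl_g_subset_fg_closed[OF B] by simp
  have "r F \<le> N" if "?P F" for F
  proof -
    have "rk (acl_g M F) \<le> rk A"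
      using dimension_function_mono[OF rk _ A] fg_closed_acl_g closed[OF that] that by blast
    then show ?thesis
      using r N that by simp
  qed
  then have "\<exists>F. ?P F \<and> (\<forall>F'. ?P F' \<longrightarrow> r F' \<le> r F)"
    by (intro ex_has_greatest_nat[of ?P "{}" r "Suc N"]) (auto intro: le_imp_less_Suc)
  then obtain F where F: "?P F" and max: "\<And>F'. ?P F' \<Longrightarrow> r F' \<le> r F"
    by auto
  have "x \<in> acl_g M F" if "x \<in> A \<inter> B" for x
  proof -
    let ?F' = "insert x F"
    have sub: "acl_g M F \<subseteq> acl_g M ?F'"
      by (intro acl_g_mono) blast
    have fin: "finite F" "finite ?F'"
      using F by auto
    have "rk (acl_g M F) \<le> rk (acl_g M ?F')"
      using dimension_function_mono[OF rk _ _ sub] fin fg_closed_acl_g by blast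
    moreover have "r ?F' \<le> r F"
      using max F that by simp
    ultimately have "rk (acl_g M F) = rk (acl_g M ?F')"
      by (simp add: r fin)
    \<comment> \<open>Nested closed sets of equal rank coincide, so \<open>x\<close> adds nothing to
      the closure of \<open>F\<close>.\<close>
    then have "acl_g M F = acl_g M ?F'"
      using rk sub fg_closed_acl_g fin unfolding dimension_function_def by metis
    then show ?thesis
      using acl_g_extensive[of ?F' M] by blast
  qed
  then have "A \<inter> B = acl_g M F"
    using closed[OF F] by blast
  then show ?thesis
    using fg_closed_acl_g[of F M] F by argo
qed

section \<open>Independence and generation of stabilizers\<close>

lemma pstab_subset_generate_if_indep:
  assumes ind: "stationary_independence M ind"
    and A: "A \<in> fg_closed M" and B: "B \<in> fg_closed M" and C: "C \<in> fg_closed M"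
    and CA: "C \<subseteq> A" and CB: "C \<subseteq> B" and ABC: "ind A C B"
  shows "pstab M C \<subseteq> generate (Aut_group M) (pstab M A \<union> pstab M B)"
proof
  let ?H = "generate (Aut_group M) (pstab M A \<union> pstab M B)"
  have invar: "indep_invariant M ind" and mono: "indep_monotone M ind"
    and trans: "indep_transitive M ind" and sym: "indep_symmetric M ind"
    and ex: "indep_existence M ind" and stat: "indep_stationary M ind"
    using ind by (simp_all add: stationary_independence_def)
  fix g assume g: "g \<in> pstab M C"
  then have gAut: "g \<in> Aut M"
    by (rule pstab_Aut)
  then have gA: "g ` A \<in> fg_closed M"
    using A by (rule fg_closed_image)
  \<comment> \<open>Any closed \<open>D\<close> above \<open>A\<close> and its image under
    \<open>g\<close> can serve as the closure of their union.\<close>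
  then obtain D where D: "D \<in> fg_closed M" "A \<subseteq> D" "g ` A \<subseteq> D"
    using A by (metis fg_closed_upper_bound)
  obtain k where k: "k \<in> pstab M B" and kAB: "ind (k ` A) B D"
    using ex A B D unfolding indep_existence_def by blast
  have kAut: "k \<in> Aut M"
    using k by (rule pstab_Aut)
  then have kA: "k ` A \<in> fg_closed M"
    using A by (rule fg_closed_image)
  have "ind (k ` A) (k ` C) (k ` B)"
    using invar A B C kAut ABC unfolding indep_invariant_def by blast
  then have "ind (k ` A) C B"
    using pstab_image_fix[OF k] CB by simp
  \<comment> \<open>Since \<open>C \<union> B = B\<close>, the relation \<open>kAB\<close> is over
    the base that transitivity requires.\<close>
  then have "ind (k ` A) C (B \<union> D)"
    using trans kA B C D kAB CB unfolding indep_transitive_def by (metis Un_absorb1)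
  then have "ind (k ` A) C D"
    using mono kA B C D unfolding indep_monotone_def by (metis Un_commute)
  then have "ind (k ` A) C X" if "X \<in> fg_closed M" "X \<subseteq> D" for X
    using mono kA C D that unfolding indep_monotone_def by (metis Un_absorb1)
  then have "ind X C (k ` A)" if "X \<in> fg_closed M" "X \<subseteq> D" for X
    using sym kA C that unfolding indep_symmetric_def by blast
  then have "ind A C (k ` A)" "ind (g ` A) C (k ` A)"
    using A gA D by auto
  moreover have "C \<subseteq> g ` A"
    using pstab_image_fix[OF g, of C] CA by blast
  moreover have "g \<in> A \<rightarrow> g ` A"
    by blast
  moreover have "\<forall>x \<in> C. g x = x"
    using pstab_fix[OF g] by blast
  moreover have "\<exists>f \<in> Aut M. \<forall>x \<in> A. f x = g x"
    using gAut by blast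
  ultimately have "\<exists>m \<in> Aut M. (\<forall>x \<in> A. m x = g x) \<and> (\<forall>x \<in> k ` A. m x = x)"
    using stat[unfolded indep_stationary_def, THEN bspec, OF A, THEN bspec, OF C,
        THEN bspec, OF kA, THEN bspec, OF gA] CA by blast
  then obtain m where m: "m \<in> Aut M" "\<forall>x \<in> A. m x = g x" "\<forall>x \<in> k ` A. m x = x"
    by blast
  have "m \<in> pstab M (k ` A)"
    using m by (simp add: pstab_def)
  then have "m \<in> ?H"
    using pstab_conj_subset_generate[OF k] by blast
  moreover have "inv_into UNIV m \<circ> g \<in> pstab M A"
    using m gAut by (intro inv_comp_in_pstab) auto
  then have "inv_into UNIV m \<circ> g \<in> ?H"
    by (blast intro: generate.incl)
  ultimately have "m \<circ> (inv_into UNIV m \<circ> g) \<in> ?H"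
    by (rule generate_Aut_comp)
  moreover have "m \<circ> (inv_into UNIV m \<circ> g) = g"
    using m by (simp add: fun_eq_iff Aut_inv_right)
  ultimately show "g \<in> ?H"
    by simp
qed

text \<open>The smallest base \<open>D\<close> lies below both \<open>A\<close> and
  \<open>B\<close>, as each is a base for \<open>X\<close> against \<open>A\<close>. Monotonicity
  then enlarges \<open>D\<close> to \<open>A \<inter> B\<close>.\<close>

lemma indep_over_Int:
  assumes mono: "indep_monotone M ind"
    and wcb: "weak_canonical_bases M ind"
    and A: "A \<in> fg_closed M" "acl M A = A" and B: "B \<in> fg_closed M"
    and AB: "A \<inter> B \<in> fg_closed M"
    and X: "X \<in> fg_closed M" "ind X B A" "ind X A A"
  shows "ind X (A \<inter> B) A"
proof -
  obtain D where D: "D \<in> fg_closed M" "ind X D A"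
      "\<forall>D' \<in> fg_closed M. ind X D' A \<longrightarrow> D \<subseteq> D'"
    using wcb A X unfolding weak_canonical_bases_def by metis
  then have sub: "D \<subseteq> A \<inter> B"
    using A B X by blast
  have "ind X D ((A \<inter> B) \<union> A)"
    using D by (simp add: Un_absorb1)
  then have "ind X (D \<union> (A \<inter> B)) A"
    using mono X D AB A unfolding indep_monotone_def by blast
  then show ?thesis
    using sub by (simp add: Un_absorb1)
qed

theorem theorem4p10:
  fixes M :: "('f, 'r, 'a) fo_structure" and rk :: "'a set \<Rightarrow> ereal"
  assumes "countable (UNIV :: 'a set)"
    and "countable_language M"
    and "\<forall>A. finite A \<longrightarrow> acl M A = acl_g M A"
    and "dimension_function M rk"
    and "stationary_independence M (rk_indep M rk)"
  shows "(\<forall>A \<in> fg_closed M. \<forall>B \<in> fg_closed M. rk_indep M rk A (A \<inter> B) B \<longrightarrow>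
            pstab M (A \<inter> B) = generate (Aut_group M) (pstab M A \<union> pstab M B)) \<and>
         (weak_canonical_bases M (rk_indep M rk) \<longrightarrow>
            (\<forall>A \<in> fg_closed M. \<forall>B \<in> fg_closed M.
               pstab M (A \<inter> B) = generate (Aut_group M) (pstab M A \<union> pstab M B)))"
proof (intro conjI impI ballI)
  let ?ind = "rk_indep M rk"
  fix A B assume A: "A \<in> fg_closed M" and B: "B \<in> fg_closed M"
  have AB: "A \<inter> B \<in> fg_closed M"
    using assms(4) A B by (rule fg_closed_Int)
  let ?H = "generate (Aut_group M) (pstab M A \<union> pstab M B)"
  have H: "?H \<subseteq> pstab M (A \<inter> B)"
    by (intro generate_pstab_subset) auto
  show "pstab M (A \<inter> B) = ?H" if "?ind A (A \<inter> B) B"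
    using pstab_subset_generate_if_indep[OF assms(5) A B AB _ _ that] H by blast
  assume wcb: "weak_canonical_bases M ?ind"
  obtain k where k: "k \<in> pstab M B" and ind: "?ind (k ` A) B A"
    using assms(5) A B unfolding stationary_independence_def indep_existence_def by blast
  have kA: "k ` A \<in> fg_closed M"
    using pstab_Aut[OF k] A by (rule fg_closed_image)
  have "?ind (k ` A) (A \<inter> B) A"
  proof (rule indep_over_Int[OF _ wcb A _ B AB kA ind])
    show "indep_monotone M ?ind"
      using assms(5) by (simp add: stationary_independence_def)
    show "acl M A = A"
      using assms(3) A by (intro acl_fg_closed) auto
    \<comment> \<open>Both relative ranks are over the same set, because
      \<open>A \<union> A = A\<close>.\<close>
    show "?ind (k ` A) A A"
      by (simp add: rk_indep_def)
  qed
  \<comment> \<open>The base only has to be contained in both sets, so the intersection of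
    \<open>A\<close> with its image under \<open>k\<close> need not be computed.\<close>
  moreover have "A \<inter> B \<subseteq> k ` A"
    using pstab_image_fix[OF k, of "A \<inter> B"] by blast
  ultimately have "pstab M (A \<inter> B) \<subseteq> generate (Aut_group M) (pstab M (k ` A) \<union> pstab M A)"
    using pstab_subset_generate_if_indep[OF assms(5) kA A AB] by blast
  also have "\<dots> \<subseteq> ?H"
  proof (rule group.generate_subgroup_incl[OF group_Aut_group])
    show "pstab M (k ` A) \<union> pstab M A \<subseteq> ?H"
      using pstab_conj_subset_generate[OF k] by (blast intro: generate.incl)
    show "subgroup ?H (Aut_group M)"
      using group_Aut_group
      by (rule group.generate_is_subgroup) (auto simp: Aut_group_def pstab_def)
  qed
  finally show "pstab M (A \<inter> B) = ?H"
    using H by blast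
qed

end
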